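(* Let $u$ be a fuzzy set on $\mathbb{R}^m$, i.e. an arbitrary function $u:\mathbb{R}^m\to[0,1]$. Then the set $D(u):=\{\alpha\in(0,1): [u]_\alpha\nsubseteq\overline{\{u>\alpha\}}\}$ is at most countable.
   Context: For $\alpha\in(0,1]$, $[u]_\alpha=\{x\in\mathbb{R}^m:u(x)\ge\alpha\}$ and $\{u>\alpha\}=\{x\in\mathbb{R}^m:u(x)>\alpha\}$; the bar denotes topological closure in $\mathbb{R}^m$. *)

theory Defs
  imports "HOL-Analysis.Analysis"
begin

definition fuzzy_set :: "(real ^ 'm \<Rightarrow> real) \<Rightarrow> bool" where
  "fuzzy_set u \<longleftrightarrow> (\<forall>x. u x \<in> {0..1})"

(* Only used for levels in (0,1]; at level 0 this is not the closure-of-support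
   convention that is common for fuzzy sets. *)
definition cut :: "(real ^ 'm \<Rightarrow> real) \<Rightarrow> real \<Rightarrow> (real ^ 'm) set" where
  "cut u \<alpha> = {x. u x \<ge> \<alpha>}"

definition strict_cut :: "(real ^ 'm \<Rightarrow> real) \<Rightarrow> real \<Rightarrow> (real ^ 'm) set" where
  "strict_cut u \<alpha> = {x. u x > \<alpha>}"

definition D :: "(real ^ 'm \<Rightarrow> real) \<Rightarrow> real set" where
  "D u = {\<alpha> \<in> {0<..<1}. \<not> cut u \<alpha> \<subseteq> closure (strict_cut u \<alpha>)}"

end

theory Submission
  imports Defs
begin

text \<open>
  A level \<open>\<alpha>\<close> is exceptional exactly when it is a local maximum value of \<open>u\<close>: if \<open>u x \<ge> \<alpha>\<close> but \<open>x\<close>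
  is not a limit of points where \<open>u > \<alpha>\<close>, then \<open>u \<le> \<alpha>\<close> near \<open>x\<close>, so \<open>u x = \<alpha>\<close> is the maximum of
  \<open>u\<close> on a neighbourhood of \<open>x\<close>. A function on a second countable space has only countably many
  local maximum values.
\<close>

text \<open>
  Shrinking the neighbourhood to a member of a countable basis keeps the maximum, so every local
  maximum value is the supremum of \<open>f\<close> over some basic set, and there are only countably many of
  these suprema.
\<close>

lemma countable_local_maximum_values:
  fixes f :: "'a::second_countable_topology \<Rightarrow> 'b::conditionally_complete_lattice"
  shows "countable {f x | x. \<exists>U. open U \<and> x \<in> U \<and> (\<forall>y\<in>U. f y \<le> f x)}"
proof -
  obtain \<B> :: "'a set set" where "countable \<B>" and basis: "topological_basis \<B>"
    using ex_countable_basis by blast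
  have "{f x | x. \<exists>U. open U \<and> x \<in> U \<and> (\<forall>y\<in>U. f y \<le> f x)} \<subseteq> (\<lambda>B. Sup (f ` B)) ` \<B>"
  proof clarify
    fix x U assume "open U" "x \<in> U" and max: "\<forall>y\<in>U. f y \<le> f x"
    then obtain B where B: "B \<in> \<B>" "x \<in> B" "B \<subseteq> U"
      using topological_basisE[OF basis] by metis
    have "Sup (f ` B) = f x"
      using B max by (intro cSup_eq_maximum) auto
    then show "f x \<in> (\<lambda>B. Sup (f ` B)) ` \<B>"
      using B(1) by (metis image_eqI)
  qed
  then show ?thesis
    using \<open>countable \<B>\<close> by (meson countable_image countable_subset)
qed

theorem theorem5p1:
  fixes u :: "real ^ 'm \<Rightarrow> real"
  assumes "fuzzy_set u"
  shows "countable (D u)"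
proof -
  have "D u \<subseteq> {u x | x. \<exists>U. open U \<and> x \<in> U \<and> (\<forall>y\<in>U. u y \<le> u x)}"
  proof
    fix \<alpha> assume "\<alpha> \<in> D u"
    then obtain x where x: "\<alpha> \<le> u x" "x \<notin> closure (strict_cut u \<alpha>)"
      by (auto simp: D_def cut_def)
    let ?U = "- closure (strict_cut u \<alpha>)"
    have le: "u y \<le> \<alpha>" if "y \<in> ?U" for y
      using that closure_subset[of "strict_cut u \<alpha>"] by (force simp: strict_cut_def)
    have "u x = \<alpha>"
      using le[of x] x by simp
    moreover have "open ?U"
      by (simp add: open_Compl)
    ultimately show "\<alpha> \<in> {u x | x. \<exists>U. open U \<and> x \<in> U \<and> (\<forall>y\<in>U. u y \<le> u x)}"
      using x(2) le by blast
  qed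
  then show ?thesis
    using countable_local_maximum_values countable_subset by blast
qed

end
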